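(* Let $M=\{a^i: i\geq 0\}\cup\{b_j: j\in\mathbb{Z}\}\cup\{0\}$ be the monoid with zero $0$ and identity $a^0=1$, where $a^ia^k=a^{i+k}$, and for $i\geq1$, $j,k\in\mathbb{Z}$: $a^ib_j=b_{i+j}$, $b_ja^i=0$, $b_jb_k=0$. Then $M$ is residually finite, $b_0$ and $b_1$ are not $\mathcal{L}$-related in $M$, but for every finite monoid $T$ and every homomorphism $\theta:M\to T$ the elements $\theta(b_0)$ and $\theta(b_1)$ are $\mathcal{L}$-related in $T$.
   Context: A monoid is residually finite if any two distinct elements are separated by a homomorphism to a finite monoid. Green's relation $\mathcal{L}$ on a monoid $T$: $x\mathcal{L}y$ iff $Tx=Ty$. *)

theory Defs
  imports "HOL-Algebra.Group"
begin

datatype Melt = A nat | B int | Zero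

fun Mmult :: "Melt \<Rightarrow> Melt \<Rightarrow> Melt" where
  "Mmult (A i) (A k) = A (i + k)"
| "Mmult (A i) (B j) = B (int i + j)"
| "Mmult (B j) (A i) = (if i = 0 then B j else Zero)"
| "Mmult (B j) (B k) = Zero"
| "Mmult Zero x = Zero"
| "Mmult (A i) Zero = Zero"
| "Mmult (B j) Zero = Zero"

definition M :: "Melt monoid" where
  "M = \<lparr>carrier = UNIV, mult = Mmult, one = A 0\<rparr>"

definition mon_hom :: "('a, 'c) monoid_scheme \<Rightarrow> ('b, 'd) monoid_scheme \<Rightarrow> ('a \<Rightarrow> 'b) set" where
  "mon_hom S T = {h. h \<in> hom S T \<and> h \<one>\<^bsub>S\<^esub> = \<one>\<^bsub>T\<^esub>}"

definition green_L :: "('a, 'c) monoid_scheme \<Rightarrow> 'a \<Rightarrow> 'a \<Rightarrow> bool" where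
  "green_L T x y \<longleftrightarrow>
     (\<lambda>t. t \<otimes>\<^bsub>T\<^esub> x) ` carrier T = (\<lambda>t. t \<otimes>\<^bsub>T\<^esub> y) ` carrier T"

text \<open>Residual finiteness. Every finite monoid is isomorphic to one whose carrier
  is a set of natural numbers, so it suffices to range over finite monoids on nat.\<close>
definition residually_finite :: "('a, 'c) monoid_scheme \<Rightarrow> bool" where
  "residually_finite S \<longleftrightarrow>
     (\<forall>x\<in>carrier S. \<forall>y\<in>carrier S. x \<noteq> y \<longrightarrow>
        (\<exists>(T :: nat monoid) h. monoid T \<and> finite (carrier T) \<and> h \<in> mon_hom S T \<and> h x \<noteq> h y))"

end

theory Submission
  imports Defs "HOL-Library.Countable"
begin

(* In a finite monoid every element g satisfies g^(i+m) = g^i for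
      some i and some m > 0.  Since b_0 = a^i b_(-i) is divisible by every power of a,
      the image of a^m fixes the image of b_0 from the left; together with
      b_1 = a b_0 this makes the images of b_0 and b_1 left multiples of each other,
      hence L-related.
   3. Residual finiteness.  A map c on a monoid with c(xy) = c(c x c y) has an image
      that is again a monoid ("collapse"), encoded on nat via to_nat; if such maps
      with finite image separate all pairs, the monoid is residually finite.  For M
      we use the collapse cp p reducing exponents of a (beyond a^0) and indices of b
      modulo p; for p large it separates any two given elements. *)

lemma Mmult_assoc: "Mmult (Mmult x y) z = Mmult x (Mmult y z)"
  by (cases x; cases y; cases z) (auto simp: add.assoc)

lemma Mmult_A0 [simp]: "Mmult (A 0) x = x" "Mmult x (A 0) = x"
  by (cases x; simp)+

lemma M_simps [simp]: "carrier M = UNIV" "mult M = Mmult" "one M = A 0"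
  by (auto simp: M_def)

lemma monoid_M: "monoid M"
  by (unfold_locales) (auto simp: Mmult_assoc)

text \<open>b_0 is not a left multiple of b_1, so b_0 and b_1 are not L-related in M.\<close>
lemma not_green_L_B0_B1: "\<not> green_L M (B 0) (B 1)"
proof
  assume "green_L M (B 0) (B 1)"
  moreover have "B 0 \<in> (\<lambda>t. Mmult t (B 0)) ` UNIV"
    by (rule image_eqI[where x = "A 0"]) auto
  ultimately have "B 0 \<in> (\<lambda>t. Mmult t (B 1)) ` UNIV"
    unfolding green_L_def by simp
  then obtain t where "Mmult t (B 1) = B 0" by auto
  then show False by (cases t) auto
qed

lemma (in monoid) green_L_if_mutual_left_multiples:
  assumes "x \<in> carrier G" "y \<in> carrier G" "u \<in> carrier G" "v \<in> carrier G"
    and x_eq: "x = u \<otimes> y" and y_eq: "y = v \<otimes> x"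
  shows "green_L G x y"
  unfolding green_L_def
proof (intro equalityI subsetI)
  fix z assume "z \<in> (\<lambda>t. t \<otimes> x) ` carrier G"
  then obtain t where t: "t \<in> carrier G" "z = t \<otimes> x" by auto
  then have "z = (t \<otimes> u) \<otimes> y" using assms(2,3) by (simp add: x_eq m_assoc)
  then show "z \<in> (\<lambda>t. t \<otimes> y) ` carrier G" using t(1) assms(3) by blast
next
  fix z assume "z \<in> (\<lambda>t. t \<otimes> y) ` carrier G"
  then obtain t where t: "t \<in> carrier G" "z = t \<otimes> y" by auto
  then have "z = (t \<otimes> v) \<otimes> x" using assms(1,4) by (simp add: y_eq m_assoc)
  then show "z \<in> (\<lambda>t. t \<otimes> x) ` carrier G" using t(1) assms(4) by blast
qed

lemma (in monoid) finite_pow_repeat: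
  assumes "finite (carrier G)" "g \<in> carrier G"
  obtains i m :: nat where "0 < m" "g [^] (i + m) = g [^] i"
proof -
  have "\<not> inj (\<lambda>n::nat. g [^] n)"
  proof
    assume "inj (\<lambda>n::nat. g [^] n)"
    moreover have "range (\<lambda>n::nat. g [^] n) \<subseteq> carrier G" using assms(2) by auto
    ultimately show False
      using assms(1) finite_subset finite_imageD[of _ UNIV] by (metis infinite_UNIV_nat)
  qed
  then obtain i j :: nat where "i < j" "g [^] i = g [^] j"
    unfolding inj_def by (metis linorder_neqE_nat)
  then show ?thesis using that[of "j - i" i] by simp
qed

lemma (in monoid) pow_period_fixes_multiples:
  fixes i m :: nat
  assumes "g \<in> carrier G" "y \<in> carrier G" "g [^] (i + m) = g [^] i"
  shows "g [^] m \<otimes> (g [^] i \<otimes> y) = g [^] i \<otimes> y"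
proof -
  have "g [^] m \<otimes> g [^] i = g [^] i"
    using nat_pow_mult[OF assms(1), of m i] assms(3) by (simp add: add.commute)
  then show ?thesis using assms by (simp flip: m_assoc)
qed

lemma mon_hom_M_mult:
  assumes "\<theta> \<in> mon_hom M T"
  shows "\<theta> (Mmult x y) = \<theta> x \<otimes>\<^bsub>T\<^esub> \<theta> y" and "\<theta> x \<in> carrier T"
  using assms unfolding mon_hom_def hom_def by auto

lemma mon_hom_M_A:
  assumes "\<theta> \<in> mon_hom M T"
  shows "\<theta> (A n) = \<theta> (A 1) [^]\<^bsub>T\<^esub> n"
proof (induction n)
  case 0
  then show ?case using assms by (simp add: mon_hom_def)
next
  case (Suc n)
  then show ?case using mon_hom_M_mult(1)[OF assms, of "A n" "A 1"] by simp
qed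

lemma green_L_image_B0_B1:
  assumes T: "monoid T" and fin: "finite (carrier T)" and \<theta>: "\<theta> \<in> mon_hom M T"
  shows "green_L T (\<theta> (B 0)) (\<theta> (B 1))"
proof -
  interpret T: monoid T by fact
  note hom = mon_hom_M_mult[OF \<theta>]
  define g where "g = \<theta> (A 1)"
  have g: "g \<in> carrier T" unfolding g_def by (rule hom(2))
  obtain i m :: nat where "0 < m" and period: "g [^]\<^bsub>T\<^esub> (i + m) = g [^]\<^bsub>T\<^esub> i"
    using T.finite_pow_repeat[OF fin g] .
  then obtain k where m: "m = Suc k" using not0_implies_Suc by blast
  text \<open>b_0 = a^i b_(-i) is fixed by the image of a^m.\<close>
  have "\<theta> (B 0) = \<theta> (A i) \<otimes>\<^bsub>T\<^esub> \<theta> (B (- int i))"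
    using hom(1)[of "A i" "B (- int i)"] by simp
  also have "\<theta> (A i) = g [^]\<^bsub>T\<^esub> i"
    unfolding g_def by (rule mon_hom_M_A[OF \<theta>])
  finally have B0_factor: "\<theta> (B 0) = g [^]\<^bsub>T\<^esub> i \<otimes>\<^bsub>T\<^esub> \<theta> (B (- int i))" .
  have fixed: "g [^]\<^bsub>T\<^esub> m \<otimes>\<^bsub>T\<^esub> \<theta> (B 0) = \<theta> (B 0)"
    unfolding B0_factor using T.pow_period_fixes_multiples[OF g hom(2) period] .
  have B1: "\<theta> (B 1) = g \<otimes>\<^bsub>T\<^esub> \<theta> (B 0)"
    using hom(1)[of "A 1" "B 0"] by (simp add: g_def)
  have B0: "\<theta> (B 0) = g [^]\<^bsub>T\<^esub> k \<otimes>\<^bsub>T\<^esub> \<theta> (B 1)"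
    using fixed g hom(2) by (simp add: m B1 T.m_assoc)
  show ?thesis
    using T.green_L_if_mutual_left_multiples[OF hom(2) hom(2) _ g B0 B1] g by simp
qed

text \<open>The image of a map c with c (x y) = c (c x c y) carries a monoid structure;
  since the statement of residual finiteness ranges over monoids on nat, the image
  is encoded injectively into nat.\<close>
definition collapse :: "('a::countable, 'b) monoid_scheme \<Rightarrow> ('a \<Rightarrow> 'a) \<Rightarrow> nat monoid" where
  "collapse S c =
     \<lparr>carrier = to_nat ` c ` carrier S,
      mult = \<lambda>u v. to_nat (c (from_nat u \<otimes>\<^bsub>S\<^esub> from_nat v)),
      one = to_nat (c \<one>\<^bsub>S\<^esub>)\<rparr>"

locale monoid_collapse = monoid S for S :: "('a::countable, 'b) monoid_scheme" +
  fixes c :: "'a \<Rightarrow> 'a"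
  assumes c_closed: "x \<in> carrier S \<Longrightarrow> c x \<in> carrier S"
    and c_mult: "\<lbrakk>x \<in> carrier S; y \<in> carrier S\<rbrakk> \<Longrightarrow> c (x \<otimes>\<^bsub>S\<^esub> y) = c (c x \<otimes>\<^bsub>S\<^esub> c y)"
begin

lemma collapse_mult:
  "\<lbrakk>x \<in> carrier S; y \<in> carrier S\<rbrakk> \<Longrightarrow>
     to_nat (c x) \<otimes>\<^bsub>collapse S c\<^esub> to_nat (c y) = to_nat (c (x \<otimes>\<^bsub>S\<^esub> y))"
  by (simp add: collapse_def c_mult)

lemma monoid_collapse: "monoid (collapse S c)"
proof (rule monoidI)
  fix u v w
  assume "u \<in> carrier (collapse S c)" "v \<in> carrier (collapse S c)" "w \<in> carrier (collapse S c)"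
  then obtain x y z where "x \<in> carrier S" "y \<in> carrier S" "z \<in> carrier S"
    and "u = to_nat (c x)" "v = to_nat (c y)" "w = to_nat (c z)"
    by (auto simp: collapse_def)
  then show "u \<otimes>\<^bsub>collapse S c\<^esub> v \<in> carrier (collapse S c)"
    and "u \<otimes>\<^bsub>collapse S c\<^esub> v \<otimes>\<^bsub>collapse S c\<^esub> w =
         u \<otimes>\<^bsub>collapse S c\<^esub> (v \<otimes>\<^bsub>collapse S c\<^esub> w)"
    by (simp_all add: collapse_mult m_assoc) (simp add: collapse_def)
next
  show "\<one>\<^bsub>collapse S c\<^esub> \<in> carrier (collapse S c)" by (simp add: collapse_def)
next
  fix u assume "u \<in> carrier (collapse S c)"
  then obtain x where "x \<in> carrier S" "u = to_nat (c x)" by (auto simp: collapse_def)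
  moreover have "\<one>\<^bsub>collapse S c\<^esub> = to_nat (c \<one>\<^bsub>S\<^esub>)" by (simp add: collapse_def)
  ultimately show "\<one>\<^bsub>collapse S c\<^esub> \<otimes>\<^bsub>collapse S c\<^esub> u = u"
    and "u \<otimes>\<^bsub>collapse S c\<^esub> \<one>\<^bsub>collapse S c\<^esub> = u"
    by (simp_all add: collapse_mult)
qed

lemma collapse_mon_hom: "to_nat \<circ> c \<in> mon_hom S (collapse S c)"
  by (auto simp: mon_hom_def hom_def collapse_mult) (auto simp: collapse_def)

end

lemma residually_finite_if_collapses_separate:
  assumes separate: "\<And>x y. \<lbrakk>x \<in> carrier S; y \<in> carrier S; x \<noteq> y\<rbrakk> \<Longrightarrow>
      \<exists>c. monoid_collapse S c \<and> finite (c ` carrier S) \<and> c x \<noteq> c y"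
  shows "residually_finite (S :: ('a::countable, 'b) monoid_scheme)"
  unfolding residually_finite_def
proof (intro ballI impI)
  fix x y assume "x \<in> carrier S" "y \<in> carrier S" "x \<noteq> y"
  then obtain c where c: "monoid_collapse S c" and "finite (c ` carrier S)" "c x \<noteq> c y"
    using separate by blast
  then have "finite (carrier (collapse S c))" "(to_nat \<circ> c) x \<noteq> (to_nat \<circ> c) y"
    by (simp_all add: collapse_def)
  then show "\<exists>(T :: nat monoid) h. monoid T \<and> finite (carrier T) \<and> h \<in> mon_hom S T \<and> h x \<noteq> h y"
    using monoid_collapse.monoid_collapse[OF c] monoid_collapse.collapse_mon_hom[OF c] by blast
qed

instance Melt :: countable by countable_datatype

fun cp :: "nat \<Rightarrow> Melt \<Rightarrow> Melt" where
  "cp p (A i) = (if i = 0 then A 0 else A (Suc ((i - 1) mod p)))"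
| "cp p (B j) = B (j mod int p)"
| "cp p Zero = Zero"

lemma cp_mult_A_A: "cp p (Mmult (A i) (A k)) = cp p (Mmult (cp p (A i)) (cp p (A k)))"
  by (cases i; cases k) (simp_all, metis mod_Suc_eq mod_add_eq)

lemma cp_mult_A_B: "cp p (Mmult (A i) (B j)) = cp p (Mmult (cp p (A i)) (cp p (B j)))"
  by (cases i) (simp_all, smt (verit) mod_add_eq mod_add_left_eq of_nat_mod)

lemma cp_mult: "cp p (Mmult x y) = cp p (Mmult (cp p x) (cp p y))"
  by (cases x; cases y) (simp_all only: cp_mult_A_A cp_mult_A_B, simp_all)

lemma monoid_collapse_cp: "monoid_collapse M (cp p)"
  by (intro monoid_collapse.intro monoid_collapse_axioms.intro monoid_M)
    (simp_all only: M_simps UNIV_I cp_mult[symmetric])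

lemma finite_range_cp:
  assumes "0 < p"
  shows "finite (range (cp p))"
proof -
  have "range (cp p) \<subseteq> A ` {..p} \<union> B ` {0..<int p} \<union> {Zero}"
  proof
    fix z assume "z \<in> range (cp p)"
    then obtain x where z: "z = cp p x" by auto
    show "z \<in> A ` {..p} \<union> B ` {0..<int p} \<union> {Zero}"
    proof (cases x)
      case (A i) then show ?thesis using z assms by (auto simp: Suc_le_eq)
    next
      case (B j)
      have "j mod int p \<in> {0..<int p}" using assms by simp
      then show ?thesis using z B by auto
    qed (use z in auto)
  qed
  then show ?thesis by (rule finite_subset) auto
qed

text \<open>A size bound below which cp p is injective.\<close>
fun size_M :: "Melt \<Rightarrow> nat" where
  "size_M (A i) = i" | "size_M (B j) = nat \<bar>j\<bar>" | "size_M Zero = 0"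

lemma cp_A_small: "i \<le> p \<Longrightarrow> cp p (A i) = A i"
  by (cases i) auto

lemma cp_separates:
  assumes "size_M x + size_M y < p" "x \<noteq> y"
  shows "cp p x \<noteq> cp p y"
proof (cases x; cases y)
  fix j k assume xy: "x = B j" "y = B k"
  show ?thesis
  proof
    assume "cp p x = cp p y"
    then have "int p dvd (j - k)" using xy by (simp add: mod_eq_dvd_iff)
    moreover have "j - k \<noteq> 0" using assms xy by simp
    ultimately have "int p \<le> \<bar>j - k\<bar>" using dvd_imp_le_int[of "j - k" "int p"] by simp
    then show False using assms xy by simp
  qed
qed (use assms in \<open>simp_all add: cp_A_small\<close>)

lemma residually_finite_M: "residually_finite M"
proof (rule residually_finite_if_collapses_separate)
  fix x y :: Melt assume "x \<noteq> y"
  define p where "p = Suc (size_M x + size_M y)"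
  then have "finite (cp p ` carrier M)" "cp p x \<noteq> cp p y"
    using finite_range_cp cp_separates \<open>x \<noteq> y\<close> by simp_all
  then show "\<exists>c. monoid_collapse M c \<and> finite (c ` carrier M) \<and> c x \<noteq> c y"
    by (intro exI[of _ "cp p"] conjI monoid_collapse_cp)
qed

theorem mainTheorem3:
  shows "monoid M \<and> residually_finite M \<and> \<not> green_L M (B 0) (B 1) \<and>
    (\<forall>T :: 'b monoid. \<forall>\<theta>. monoid T \<and> finite (carrier T) \<and> \<theta> \<in> mon_hom M T \<longrightarrow>
        green_L T (\<theta> (B 0)) (\<theta> (B 1)))"
proof (intro conjI allI impI)
  fix T :: "'b monoid" and \<theta>
  assume "monoid T \<and> finite (carrier T) \<and> \<theta> \<in> mon_hom M T"
  then show "green_L T (\<theta> (B 0)) (\<theta> (B 1))" by (intro green_L_image_B0_B1) simp_all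
qed (rule monoid_M residually_finite_M not_green_L_B0_B1)+

end
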